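(* Let $G,H$ be finite abstract simplicial complexes and let $A=\psi(G)$, $B=\psi(H)$ be their connection graphs. Then $\Theta(A+B)=\Theta(A)+\Theta(B)$ and $\Theta(A\cdot B)=\Theta(A)\,\Theta(B)$, where $\Theta$ is the Shannon capacity, $A+B$ is the disjoint union and $A\cdot B$ is the strong product.
   Context: A finite abstract simplicial complex $G$ is a finite set of finite non-empty sets closed under taking non-empty subsets. The connection graph $\psi(G)$ is the finite simple graph with vertex set $G$ in which distinct $a,b$ are adjacent iff $a\cap b\neq\emptyset$. The strong product of graphs $(V,E)$ and $(W,F)$ has vertex set $V\times W$, with distinct $(a,b)$, $(c,d)$ adjacent iff ($a=c$ or $(a,c)\in E$) and ($b=d$ or $(b,d)\in F$). The independence number $i(A)$ is the maximal cardinality of a set of pairwise non-adjacent vertices of $A$. The Shannon capacity is $\Theta(A)=\lim_{n\to\infty} i(A^n)^{1/n}$, where $A^n$ is the $n$-fold strong product of $A$ with itself. *)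

theory Defs
  imports Complex_Main "Graph_Theory.Pair_Digraph"
begin

definition fin_simplicial_complex :: "'a set set \<Rightarrow> bool" where
  "fin_simplicial_complex G \<longleftrightarrow>
     finite G \<and> (\<forall>a\<in>G. finite a \<and> a \<noteq> {}) \<and> (\<forall>a\<in>G. \<forall>b. b \<subseteq> a \<and> b \<noteq> {} \<longrightarrow> b \<in> G)"

text \<open>
  A finite simple graph is a loop-free symmetric digraph without parallel arcs on a finite vertex
  set (\<open>pair_graph\<close>); each undirected edge is represented by both of its orientations.
\<close>

definition connection_graph :: "'a set set \<Rightarrow> 'a set pair_pre_digraph" where
  "connection_graph G =
     \<lparr>pverts = G, parcs = {(a, b). a \<in> G \<and> b \<in> G \<and> a \<noteq> b \<and> a \<inter> b \<noteq> {}}\<rparr>"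

definition disjoint_union ::
    "'a pair_pre_digraph \<Rightarrow> 'b pair_pre_digraph \<Rightarrow> ('a + 'b) pair_pre_digraph" where
  "disjoint_union A B =
     \<lparr>pverts = pverts A <+> pverts B,
      parcs = map_prod Inl Inl ` parcs A \<union> map_prod Inr Inr ` parcs B\<rparr>"

definition strong_product ::
    "'a pair_pre_digraph \<Rightarrow> 'b pair_pre_digraph \<Rightarrow> ('a \<times> 'b) pair_pre_digraph" where
  "strong_product A B =
     \<lparr>pverts = pverts A \<times> pverts B,
      parcs = {((a, b), (c, d)).
        (a, b) \<in> pverts A \<times> pverts B \<and> (c, d) \<in> pverts A \<times> pverts B \<and> (a, b) \<noteq> (c, d) \<and>
        (a = c \<or> (a, c) \<in> parcs A) \<and> (b = d \<or> (b, d) \<in> parcs B)}\<rparr>"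

text \<open>
  The vertex type of an iterated product would depend on the number of factors. Tuples are
  therefore encoded as lists: \<open>(x, xs)\<close> becomes \<open>x # xs\<close>, and the empty product is the one-vertex
  graph.
\<close>

primrec strong_power :: "'a pair_pre_digraph \<Rightarrow> nat \<Rightarrow> 'a list pair_pre_digraph" where
  "strong_power A 0 = \<lparr>pverts = {[]}, parcs = {}\<rparr>"
| "strong_power A (Suc n) =
     (let P = strong_product A (strong_power A n); cons = (\<lambda>(x, xs). x # xs)
      in \<lparr>pverts = cons ` pverts P, parcs = map_prod cons cons ` parcs P\<rparr>)"

definition independent_set :: "'a pair_pre_digraph \<Rightarrow> 'a set \<Rightarrow> bool" where
  "independent_set A S \<longleftrightarrow>
     S \<subseteq> pverts A \<and> (\<forall>x\<in>S. \<forall>y\<in>S. x \<noteq> y \<longrightarrow> (x, y) \<notin> parcs A)"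

definition independence_number :: "'a pair_pre_digraph \<Rightarrow> nat" where
  "independence_number A = Max (card ` {S. independent_set A S})"

definition shannon_capacity :: "'a pair_pre_digraph \<Rightarrow> real" where
  "shannon_capacity A = lim (\<lambda>n. root n (real (independence_number (strong_power A n))))"


lemma pair_graphI:
  assumes "finite (pverts A)" "parcs A \<subseteq> pverts A \<times> pverts A" "sym (parcs A)" "irrefl (parcs A)"
  shows "pair_graph A"
proof -
  have "finite (parcs A)"
    using assms(1,2) finite_subset by blast
  then show ?thesis
    using assms by unfold_locales (auto simp: symmetric_def irrefl_def)
qed

lemma pair_graphD:
  assumes "pair_graph A"
  shows "finite (pverts A)" "parcs A \<subseteq> pverts A \<times> pverts A" "sym (parcs A)" "irrefl (parcs A)"
proof -
  interpret pair_graph A by fact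
  show "finite (pverts A)" "parcs A \<subseteq> pverts A \<times> pverts A"
    by (auto dest: in_arcsD1 in_arcsD2 simp: pair_finite_verts)
  show "sym (parcs A)" "irrefl (parcs A)"
    using pair_sym_arcs by (auto simp: symmetric_def irrefl_def dest: pair_no_loops)
qed

lemma pair_graph_connection_graph:
  "fin_simplicial_complex G \<Longrightarrow> pair_graph (connection_graph G)"
  by (rule pair_graphI)
    (auto simp: connection_graph_def fin_simplicial_complex_def sym_def irrefl_def)

lemma pair_graph_disjoint_union:
  assumes "pair_graph A" "pair_graph B"
  shows "pair_graph (disjoint_union A B)"
  using pair_graphD[OF assms(1)] pair_graphD[OF assms(2)]
  by (intro pair_graphI) (force simp: disjoint_union_def sym_def irrefl_def)+

lemma pair_graph_strong_product:
  assumes "pair_graph A" "pair_graph B"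
  shows "pair_graph (strong_product A B)"
  using pair_graphD[OF assms(1)] pair_graphD[OF assms(2)]
  by (intro pair_graphI) (auto simp: strong_product_def sym_def irrefl_def)

lemma pverts_strong_power:
  "pverts (strong_power A n) = {xs. length xs = n \<and> set xs \<subseteq> pverts A}"
proof (induction n)
  case (Suc n)
  then show ?case
    by (auto simp: Let_def strong_product_def image_iff length_Suc_conv)
qed auto

lemma parcs_strong_power:
  "(xs, ys) \<in> parcs (strong_power A n) \<longleftrightarrow>
     xs \<in> pverts (strong_power A n) \<and> ys \<in> pverts (strong_power A n) \<and> xs \<noteq> ys \<and>
     (\<forall>i<n. xs ! i = ys ! i \<or> (xs ! i, ys ! i) \<in> parcs A)"
proof (induction n arbitrary: xs ys)
  case (Suc n)
  show ?case
  proof (cases "xs \<in> pverts (strong_power A (Suc n)) \<and> ys \<in> pverts (strong_power A (Suc n))")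
    case True
    then obtain x xs' y ys' where e: "xs = x # xs'" "ys = y # ys'"
      by (auto simp: pverts_strong_power length_Suc_conv simp del: strong_power.simps)
    have "(xs, ys) \<in> parcs (strong_power A (Suc n)) \<longleftrightarrow>
      ((x, xs'), (y, ys')) \<in> parcs (strong_product A (strong_power A n))"
      unfolding e by (force simp: Let_def)
    also have "\<dots> \<longleftrightarrow> xs \<noteq> ys \<and> (\<forall>i<Suc n. xs ! i = ys ! i \<or> (xs ! i, ys ! i) \<in> parcs A)"
    proof -
      have l: "length xs' = n" "length ys' = n" "xs' \<in> pverts (strong_power A n)"
        "ys' \<in> pverts (strong_power A n)" "x \<in> pverts A" "y \<in> pverts A"
        using True by (auto simp: e pverts_strong_power simp del: strong_power.simps)
      then have "xs' = ys' \<or> (xs', ys') \<in> parcs (strong_power A n) \<longleftrightarrow>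
          (\<forall>i<n. xs' ! i = ys' ! i \<or> (xs' ! i, ys' ! i) \<in> parcs A)"
        using Suc.IH by auto
      then show ?thesis
        using l by (simp add: strong_product_def e All_less_Suc2)
    qed
    finally show ?thesis using True by blast
  next
    case False
    then show ?thesis
      by (auto simp: Let_def strong_product_def)
  qed
qed simp

lemma pair_graph_strong_power:
  assumes "pair_graph A"
  shows "pair_graph (strong_power A n)"
proof (rule pair_graphI)
  show "finite (pverts (strong_power A n))"
    using finite_lists_length_eq[OF pair_graphD(1)[OF assms], of n]
    by (simp add: pverts_strong_power conj_commute)
  show "sym (parcs (strong_power A n))"
    using pair_graphD(3)[OF assms] by (auto simp: sym_def parcs_strong_power)
qed (auto simp: parcs_strong_power irrefl_def)

lemma independence_number_ge:
  assumes "finite (pverts A)" "independent_set A S"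
  shows "card S \<le> independence_number A"
proof -
  have "finite {S. independent_set A S}"
    by (rule finite_subset[of _ "Pow (pverts A)"]) (use assms in \<open>auto simp: independent_set_def\<close>)
  then show ?thesis
    unfolding independence_number_def using assms(2) by (intro Max_ge) auto
qed

lemma independence_number_attained:
  assumes "finite (pverts A)"
  obtains S where "independent_set A S" "card S = independence_number A"
proof -
  have "finite {S. independent_set A S}"
    by (rule finite_subset[of _ "Pow (pverts A)"]) (use assms in \<open>auto simp: independent_set_def\<close>)
  moreover have "independent_set A {}"
    by (simp add: independent_set_def)
  ultimately have "independence_number A \<in> card ` {S. independent_set A S}"
    unfolding independence_number_def by (intro Max_in) auto
  then show ?thesis using that by auto
qed

lemma independence_number_strong_power_add:
  assumes "pair_graph A"
  shows "independence_number (strong_power A m) * independence_number (strong_power A n)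
           \<le> independence_number (strong_power A (m + n))"
proof -
  note fin = pair_graphD(1)[OF pair_graph_strong_power[OF assms]]
  obtain S where S: "independent_set (strong_power A m) S"
      "card S = independence_number (strong_power A m)"
    using independence_number_attained[OF fin] .
  obtain T where T: "independent_set (strong_power A n) T"
      "card T = independence_number (strong_power A n)"
    using independence_number_attained[OF fin] .
  let ?f = "\<lambda>(xs, ys). xs @ ys"
  have len: "length xs = m" if "xs \<in> S" for xs
    using S(1) that by (auto simp: independent_set_def pverts_strong_power)
  have inj: "inj_on ?f (S \<times> T)"
    by (auto simp: inj_on_def dest!: len)
  have "independent_set (strong_power A (m + n)) (?f ` (S \<times> T))"
    unfolding independent_set_def
  proof (intro conjI ballI impI notI)
    show "?f ` (S \<times> T) \<subseteq> pverts (strong_power A (m + n))"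
      using S(1) T(1) unfolding independent_set_def pverts_strong_power by fastforce
  next
    fix u v
    assume "u \<in> ?f ` (S \<times> T)" "v \<in> ?f ` (S \<times> T)" and ne: "u \<noteq> v"
      and arc: "(u, v) \<in> parcs (strong_power A (m + n))"
    then obtain s t s' t' where uv: "u = s @ t" "v = s' @ t'"
        and mem: "s \<in> S" "t \<in> T" "s' \<in> S" "t' \<in> T" by auto
    have adj: "u ! i = v ! i \<or> (u ! i, v ! i) \<in> parcs A" if "i < m + n" for i
      using arc that by (auto simp: parcs_strong_power)
    have "s ! i = s' ! i \<or> (s ! i, s' ! i) \<in> parcs A" if "i < m" for i
      using adj[of i] that len mem by (simp add: uv nth_append)
    then have "s = s'"
      using S(1) mem(1,3) unfolding independent_set_def parcs_strong_power by blast
    moreover have "t ! i = t' ! i \<or> (t ! i, t' ! i) \<in> parcs A" if "i < n" for i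
      using adj[of "m + i"] that len mem by (simp add: uv nth_append)
    then have "t = t'"
      using T(1) mem(2,4) unfolding independent_set_def parcs_strong_power by blast
    ultimately show False using ne uv by simp
  qed
  from independence_number_ge[OF fin this] show ?thesis
    by (simp add: card_image[OF inj] card_cartesian_product S T)
qed

lemma supermultiplicative_root_convergent:
  fixes a :: "nat \<Rightarrow> real"
  assumes super: "\<And>m n. a m * a n \<le> a (m + n)"
    and ge1: "\<And>n. 1 \<le> a n" and le: "\<And>n. a n \<le> C ^ n"
  shows "convergent (\<lambda>n. root n (a n))"
proof -
  define b where "b n = root n (a n)" for n
  define L where "L = (SUP n\<in>{1..}. b n)"
  have C: "1 \<le> C" using ge1[of 1] le[of 1] by simp
  have bC: "b n \<le> C" if "n \<ge> 1" for n
  proof -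
    have "b n \<le> root n (C ^ n)" unfolding b_def using le that by simp
    then show ?thesis using that C by (simp add: real_root_power_cancel)
  qed
  have bdd: "bdd_above (b ` {1..})" using bC by (intro bdd_aboveI2) auto
  have bL: "b n \<le> L" if "n \<ge> 1" for n
    unfolding L_def using that bdd by (intro cSUP_upper) auto
  have pow: "a m ^ q \<le> a (m * q)" for m q
  proof (induction q)
    case (Suc q)
    have "a m ^ Suc q \<le> a m * a (m * q)"
      using Suc ge1[of m] by (simp add: mult_left_mono)
    also have "\<dots> \<le> a (m * Suc q)" using super[of m "m * q"] by simp
    finally show ?case .
  qed (use ge1 in simp)
  have lower: "b m powr (1 - real m / real n) \<le> b n" if m: "m \<ge> 1" and n: "n \<ge> 1" for m n
  proof -
    define q r where "q = n div m" and "r = n mod m"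
    have nqr: "n = m * q + r" "r < m" using m by (auto simp: q_def r_def)
    have b1: "b m \<ge> 1" unfolding b_def using ge1[of m] m by simp
    have am: "a m = b m powr m"
      using b1 m ge1[of m] by (simp add: powr_realpow b_def)
    have "b m powr (1 - real m / real n) \<le> b m powr (real (m * q) / real n)"
    proof (rule powr_mono[OF _ b1])
      have "real n - real m \<le> real (m * q)" using nqr by linarith
      then have "(real n - real m) / real n \<le> real (m * q) / real n"
        by (intro divide_right_mono) auto
      then show "1 - real m / real n \<le> real (m * q) / real n"
        using n by (simp add: diff_divide_distrib)
    qed
    also have "\<dots> = root n (a m ^ q)"
    proof -
      have "a m ^ q = b m powr (real (m * q))"
        using b1 by (simp add: am powr_power mult.commute)
      then show ?thesis using n b1 by (simp add: root_powr_inverse powr_powr divide_inverse)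
    qed
    also have "\<dots> \<le> b n" unfolding b_def
    proof -
      have "a m ^ q \<le> a (m * q) * 1" using pow by simp
      also have "\<dots> \<le> a (m * q) * a r"
        by (rule mult_left_mono[OF ge1]) (use ge1[of "m * q"] in linarith)
      also have "\<dots> \<le> a n" using super[of "m * q" r] by (simp flip: nqr(1))
      finally show "root n (a m ^ q) \<le> root n (a n)" using n by simp
    qed
    finally show ?thesis .
  qed
  have "b \<longlonglongrightarrow> L"
  proof (rule order_tendstoI)
    fix y assume "L < y"
    then show "eventually (\<lambda>n. b n < y) sequentially"
      using bL by (intro eventually_sequentiallyI[of 1]) (meson le_less_trans)
  next
    fix y assume "y < L"
    then obtain m where m: "m \<ge> 1" "y < b m"
      unfolding L_def using bdd by (subst (asm) less_cSUP_iff) auto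
    have "b m \<ge> 1" unfolding b_def using ge1[of m] m by simp
    then have "(\<lambda>n. b m powr (1 - real m / real n)) \<longlonglongrightarrow> b m powr (1 - 0)"
      by (intro tendsto_intros lim_const_over_n) auto
    then have "eventually (\<lambda>n. y < b m powr (1 - real m / real n)) sequentially"
      using m \<open>b m \<ge> 1\<close> by (intro order_tendstoD(1)) auto
    then show "eventually (\<lambda>n. y < b n) sequentially"
      using eventually_ge_at_top[of 1]
      by eventually_elim (use lower m in \<open>meson less_le_trans\<close>)
  qed
  then show ?thesis unfolding b_def convergent_def by blast
qed

text \<open>The limit defining the Shannon capacity exists for every finite simple graph.\<close>

lemma shannon_capacity_LIMSEQ:
  assumes "pair_graph A"
  shows "(\<lambda>n. root n (real (independence_number (strong_power A n)))) \<longlonglongrightarrow> shannon_capacity A"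
proof -
  let ?a = "\<lambda>n. independence_number (strong_power A n)"
  note finA = pair_graphD(1)[OF assms]
  note fin = pair_graphD(1)[OF pair_graph_strong_power[OF assms]]
  have card: "card (pverts (strong_power A n)) = card (pverts A) ^ n" for n
    using card_lists_length_eq[OF finA, of n] by (simp add: pverts_strong_power conj_commute)
  have le: "?a n \<le> card (pverts A) ^ n" for n
  proof -
    obtain S where "independent_set (strong_power A n) S" "card S = ?a n"
      using independence_number_attained[OF fin] .
    then show ?thesis
      using card_mono[OF fin, of S n] by (simp add: card independent_set_def)
  qed
  have "convergent (\<lambda>n. root n (real (?a n)))"
  proof (cases "pverts A = {}")
    case True
    have "root n (real (?a n)) = 0" for n
      using le[of n] True by (cases n) auto
    then show ?thesis by (simp add: convergent_const)
  next
    case False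
    then obtain x where x: "x \<in> pverts A" by blast
    have ge1: "1 \<le> ?a n" for n
    proof -
      have "independent_set (strong_power A n) {replicate n x}"
        using x by (auto simp: independent_set_def pverts_strong_power)
      from independence_number_ge[OF fin this] show ?thesis by simp
    qed
    show ?thesis
    proof (rule supermultiplicative_root_convergent)
      show "real (?a m) * real (?a n) \<le> real (?a (m + n))" for m n
        using independence_number_strong_power_add[OF assms, of m n]
        by (metis of_nat_le_iff of_nat_mult)
      show "1 \<le> real (?a n)" for n using ge1[of n] by simp
      show "real (?a n) \<le> real (card (pverts A)) ^ n" for n
        using le[of n] by (metis of_nat_le_iff of_nat_power)
    qed
  qed
  then show ?thesis unfolding shannon_capacity_def by (simp add: convergent_LIMSEQ_iff)
qed

end

theory Submission
  imports Defs
begin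

text \<open>
  The Shannon capacity of a connection graph is the number of vertices of its complex. Choose a
  vertex in each simplex and send the simplex to the corresponding singleton. Two simplices with
  the same image share a vertex, so they are equal or adjacent: the fibres of this map are cliques.
  Its image consists of singletons, which are pairwise non-adjacent. Such a map onto an independent
  set \<open>S\<close> (\<open>clique_retraction\<close> below) forces the independence number to be \<open>card S\<close>: an independent
  set meets each of the \<open>card S\<close> cliques at most once, and \<open>S\<close> itself attains the bound.

  What makes this argument decide the capacity is that the structure is inherited by constructions.
  Applied coordinatewise, the map shows that the \<open>n\<close>-th strong power has independence number
  \<open>card S ^ n\<close>, so the capacity is exactly \<open>card S\<close> (\<open>shannon_capacity_clique_retraction\<close>). Applied to
  the two parts of \<open>A + B\<close>, or to the two coordinates of \<open>A \<cdot> B\<close>, it produces independent sets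
  \<open>S <+> T\<close> and \<open>S \<times> T\<close>, whose cardinalities are the sum and the product.
\<close>

text \<open>
  The conditions say that the independence number and the clique cover number coincide: the
  fibres of \<open>f\<close> cover the graph by at most \<open>card S\<close> cliques. Indexing the cliques by \<open>S\<close> itself
  avoids a separate type of labels.
\<close>

definition clique_retraction :: "'a pair_pre_digraph \<Rightarrow> 'a set \<Rightarrow> ('a \<Rightarrow> 'a) \<Rightarrow> bool" where
  "clique_retraction A S f \<longleftrightarrow>
     finite (pverts A) \<and> independent_set A S \<and> f ` pverts A \<subseteq> S \<and>
     (\<forall>x\<in>pverts A. \<forall>y\<in>pverts A. f x = f y \<longrightarrow> x = y \<or> (x, y) \<in> parcs A)"

lemma clique_retraction_finite:
  assumes "clique_retraction A S f"
  shows "finite S"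
  using assms unfolding clique_retraction_def independent_set_def by (meson finite_subset)

text \<open>An independent set contains at most one point of each clique, so \<open>f\<close> is injective on it.\<close>

lemma independence_number_clique_retraction:
  assumes "clique_retraction A S f"
  shows "independence_number A = card S"
proof (rule antisym)
  have fin: "finite (pverts A)"
    using assms by (simp add: clique_retraction_def)
  obtain I where I: "independent_set A I" "card I = independence_number A"
    using independence_number_attained[OF fin] .
  have "inj_on f I" "f ` I \<subseteq> S"
    using assms I(1) unfolding clique_retraction_def independent_set_def inj_on_def by blast+
  then show "independence_number A \<le> card S"
    using card_inj_on_le[OF _ _ clique_retraction_finite[OF assms]] I(2) by metis
  show "card S \<le> independence_number A"
    using independence_number_ge[OF fin] assms by (simp add: clique_retraction_def)
qed

lemma clique_retraction_strong_power:
  assumes "clique_retraction A S f"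
  shows "clique_retraction (strong_power A n) {xs. set xs \<subseteq> S \<and> length xs = n} (map f)"
proof -
  have fin: "finite (pverts A)" and S: "independent_set A S" and f: "f ` pverts A \<subseteq> S"
    and fib: "\<And>x y. x \<in> pverts A \<Longrightarrow> y \<in> pverts A \<Longrightarrow> f x = f y \<Longrightarrow> x = y \<or> (x, y) \<in> parcs A"
    using assms by (auto simp: clique_retraction_def)
  have "finite (pverts (strong_power A n))"
    using finite_lists_length_eq[OF fin, of n] by (simp add: pverts_strong_power conj_commute)
  moreover have "independent_set (strong_power A n) {xs. set xs \<subseteq> S \<and> length xs = n}"
    unfolding independent_set_def
  proof (intro conjI ballI impI notI)
    show "{xs. set xs \<subseteq> S \<and> length xs = n} \<subseteq> pverts (strong_power A n)"
      using S by (auto simp: pverts_strong_power independent_set_def)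
  next
    fix xs ys
    assume xs: "xs \<in> {xs. set xs \<subseteq> S \<and> length xs = n}"
      and ys: "ys \<in> {xs. set xs \<subseteq> S \<and> length xs = n}"
      and ne: "xs \<noteq> ys" and arc: "(xs, ys) \<in> parcs (strong_power A n)"
    have "xs ! i = ys ! i" if "i < n" for i
    proof -
      have "xs ! i \<in> S" "ys ! i \<in> S"
        using xs ys that by (auto intro: subsetD[OF _ nth_mem])
      then show ?thesis
        using arc S that unfolding parcs_strong_power independent_set_def by blast
    qed
    then show False
      using xs ys ne by (simp add: list_eq_iff_nth_eq)
  qed
  moreover have "map f ` pverts (strong_power A n) \<subseteq> {xs. set xs \<subseteq> S \<and> length xs = n}"
    using f by (auto simp: pverts_strong_power subset_iff)
  moreover have "xs = ys \<or> (xs, ys) \<in> parcs (strong_power A n)"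
    if xs: "xs \<in> pverts (strong_power A n)" and ys: "ys \<in> pverts (strong_power A n)"
      and eq: "map f xs = map f ys" for xs ys
  proof -
    have "xs ! i = ys ! i \<or> (xs ! i, ys ! i) \<in> parcs A" if "i < n" for i
    proof (rule fib)
      have len: "length xs = n" "length ys = n"
        using xs ys by (auto simp: pverts_strong_power)
      show "xs ! i \<in> pverts A" "ys ! i \<in> pverts A"
        using xs ys that by (auto simp: pverts_strong_power intro: subsetD[OF _ nth_mem])
      show "f (xs ! i) = f (ys ! i)"
        using eq that len by (metis nth_map)
    qed
    then show ?thesis
      using xs ys by (auto simp: parcs_strong_power)
  qed
  ultimately show ?thesis
    by (auto simp: clique_retraction_def)
qed

lemma shannon_capacity_clique_retraction:
  assumes "clique_retraction A S f"
  shows "shannon_capacity A = card S"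
proof -
  have "independence_number (strong_power A n) = card S ^ n" for n
    using independence_number_clique_retraction[OF clique_retraction_strong_power[OF assms]]
      card_lists_length_eq[OF clique_retraction_finite[OF assms]] by simp
  then have "root n (real (independence_number (strong_power A n))) = real (card S)"
    if "n \<ge> 1" for n
    using that by (simp add: real_root_power_cancel)
  \<comment> \<open>The term at \<open>n = 0\<close> is excluded because \<open>root 0\<close> is the zero function by convention.\<close>
  then have "(\<lambda>n. root n (real (independence_number (strong_power A n)))) \<longlonglongrightarrow> real (card S)"
    by (intro tendsto_eventually eventually_sequentiallyI[of 1])
  then show ?thesis
    unfolding shannon_capacity_def by (rule limI)
qed

lemma clique_retraction_disjoint_union:
  assumes "clique_retraction A S f" "clique_retraction B T g"
  shows "clique_retraction (disjoint_union A B) (S <+> T) (map_sum f g)"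
  unfolding clique_retraction_def
proof (intro conjI ballI impI)
  let ?D = "disjoint_union A B"
  have S: "S \<subseteq> pverts A" "\<And>x x'. x \<in> S \<Longrightarrow> x' \<in> S \<Longrightarrow> (x, x') \<in> parcs A \<Longrightarrow> x = x'"
    and f: "\<And>x. x \<in> pverts A \<Longrightarrow> f x \<in> S"
      "\<And>x x'. x \<in> pverts A \<Longrightarrow> x' \<in> pverts A \<Longrightarrow> f x = f x' \<Longrightarrow> x = x' \<or> (x, x') \<in> parcs A"
    using assms(1) by (auto simp: clique_retraction_def independent_set_def)
  have T: "T \<subseteq> pverts B" "\<And>y y'. y \<in> T \<Longrightarrow> y' \<in> T \<Longrightarrow> (y, y') \<in> parcs B \<Longrightarrow> y = y'"
    and g: "\<And>y. y \<in> pverts B \<Longrightarrow> g y \<in> T"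
      "\<And>y y'. y \<in> pverts B \<Longrightarrow> y' \<in> pverts B \<Longrightarrow> g y = g y' \<Longrightarrow> y = y' \<or> (y, y') \<in> parcs B"
    using assms(2) by (auto simp: clique_retraction_def independent_set_def)
  have V: "pverts ?D = pverts A <+> pverts B"
    by (simp add: disjoint_union_def)
  have arc_Inl: "(Inl x, Inl x') \<in> parcs ?D \<longleftrightarrow> (x, x') \<in> parcs A" for x x'
    by (force simp: disjoint_union_def)
  have arc_Inr: "(Inr y, Inr y') \<in> parcs ?D \<longleftrightarrow> (y, y') \<in> parcs B" for y y'
    by (force simp: disjoint_union_def)
  have arc_mixed: "(Inl x, Inr y) \<notin> parcs ?D" "(Inr y, Inl x) \<notin> parcs ?D" for x y
    by (auto simp: disjoint_union_def)
  show "finite (pverts ?D)"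
    using assms by (simp add: V clique_retraction_def)
  show "independent_set ?D (S <+> T)"
    unfolding independent_set_def V
  proof (intro conjI ballI impI)
    show "S <+> T \<subseteq> pverts A <+> pverts B"
      using S(1) T(1) by auto
    show "(u, v) \<notin> parcs ?D" if "u \<in> S <+> T" "v \<in> S <+> T" "u \<noteq> v" for u v
      using that S(2) T(2) by (auto simp: arc_Inl arc_Inr arc_mixed)
  qed
  show "map_sum f g ` pverts ?D \<subseteq> S <+> T"
    using f(1) g(1) by (auto simp: V)
  show "u = v \<or> (u, v) \<in> parcs ?D"
    if "u \<in> pverts ?D" "v \<in> pverts ?D" "map_sum f g u = map_sum f g v" for u v
    using that by (auto simp: V arc_Inl arc_Inr dest: f(2)[rotated 2] g(2)[rotated 2])
qed

text \<open>
  Closed neighbourhoods in a strong product are products of closed neighbourhoods, hence products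
  of cliques are cliques and products of independent sets are independent.
\<close>

lemma clique_retraction_strong_product:
  assumes "clique_retraction A S f" "clique_retraction B T g"
  shows "clique_retraction (strong_product A B) (S \<times> T) (map_prod f g)"
  unfolding clique_retraction_def
proof (intro conjI ballI impI)
  let ?P = "strong_product A B"
  have S: "S \<subseteq> pverts A" "\<And>x x'. x \<in> S \<Longrightarrow> x' \<in> S \<Longrightarrow> (x, x') \<in> parcs A \<Longrightarrow> x = x'"
    and f: "\<And>x. x \<in> pverts A \<Longrightarrow> f x \<in> S"
      "\<And>x x'. x \<in> pverts A \<Longrightarrow> x' \<in> pverts A \<Longrightarrow> f x = f x' \<Longrightarrow> x = x' \<or> (x, x') \<in> parcs A"
    using assms(1) by (auto simp: clique_retraction_def independent_set_def)
  have T: "T \<subseteq> pverts B" "\<And>y y'. y \<in> T \<Longrightarrow> y' \<in> T \<Longrightarrow> (y, y') \<in> parcs B \<Longrightarrow> y = y'"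
    and g: "\<And>y. y \<in> pverts B \<Longrightarrow> g y \<in> T"
      "\<And>y y'. y \<in> pverts B \<Longrightarrow> y' \<in> pverts B \<Longrightarrow> g y = g y' \<Longrightarrow> y = y' \<or> (y, y') \<in> parcs B"
    using assms(2) by (auto simp: clique_retraction_def independent_set_def)
  have V: "pverts ?P = pverts A \<times> pverts B"
    by (simp add: strong_product_def)
  show "finite (pverts ?P)"
    using assms by (simp add: V clique_retraction_def)
  show "independent_set ?P (S \<times> T)"
    unfolding independent_set_def V
  proof (intro conjI ballI impI)
    show "S \<times> T \<subseteq> pverts A \<times> pverts B"
      using S(1) T(1) by auto
    show "(u, v) \<notin> parcs ?P" if uv: "u \<in> S \<times> T" "v \<in> S \<times> T" "u \<noteq> v" for u v
    proof
      assume "(u, v) \<in> parcs ?P"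
      then have "fst u = fst v \<or> (fst u, fst v) \<in> parcs A" "snd u = snd v \<or> (snd u, snd v) \<in> parcs B"
        by (auto simp: strong_product_def)
      then have "fst u = fst v" "snd u = snd v"
        using uv(1,2) S(2) T(2) by (auto simp: mem_Times_iff)
      then show False
        using uv(3) by (simp add: prod_eq_iff)
    qed
  qed
  show "map_prod f g ` pverts ?P \<subseteq> S \<times> T"
    using f(1) g(1) by (auto simp: V)
  show "u = v \<or> (u, v) \<in> parcs ?P"
    if uv: "u \<in> pverts ?P" "v \<in> pverts ?P" "map_prod f g u = map_prod f g v" for u v
  proof -
    have "f (fst u) = f (fst v)" "g (snd u) = g (snd v)"
      using uv(3) by (auto simp: map_prod_def split_beta)
    then have "fst u = fst v \<or> (fst u, fst v) \<in> parcs A" "snd u = snd v \<or> (snd u, snd v) \<in> parcs B"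
      using uv(1,2) f(2) g(2) by (auto simp: V mem_Times_iff)
    then show ?thesis
      using uv(1,2) by (cases u; cases v) (auto simp: strong_product_def)
  qed
qed

text \<open>
  Closure under non-empty subsets enters exactly here: it makes the singleton of the chosen vertex
  a simplex.
\<close>

lemma clique_retraction_connection_graph:
  assumes "fin_simplicial_complex G"
  shows "clique_retraction (connection_graph G) {a \<in> G. is_singleton a} (\<lambda>a. {SOME v. v \<in> a})"
proof -
  note complex = assms[unfolded fin_simplicial_complex_def]
  have fin: "finite G"
    using complex by (rule conjunct1)
  have nonempty: "\<forall>a\<in>G. finite a \<and> a \<noteq> {}"
    using complex[THEN conjunct2] by (rule conjunct1)
  have closed: "\<forall>a\<in>G. \<forall>b. b \<subseteq> a \<and> b \<noteq> {} \<longrightarrow> b \<in> G"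
    using complex[THEN conjunct2] by (rule conjunct2)
  have vert: "(SOME v. v \<in> a) \<in> a" and sing: "{SOME v. v \<in> a} \<in> G" if "a \<in> G" for a
  proof -
    have "a \<noteq> {}"
      using nonempty that by blast
    then show "(SOME v. v \<in> a) \<in> a"
      by (simp add: some_in_eq)
    then show "{SOME v. v \<in> a} \<in> G"
      by (intro closed[rule_format, OF that]) simp
  qed
  have "a = b \<or> (a, b) \<in> parcs (connection_graph G)"
    if "a \<in> G" "b \<in> G" "(SOME v. v \<in> a) = (SOME v. v \<in> b)" for a b
    using vert[OF that(1)] vert[OF that(2)] that by (auto simp: connection_graph_def)
  moreover have "independent_set (connection_graph G) {a \<in> G. is_singleton a}"
    by (auto simp: independent_set_def connection_graph_def is_singleton_def)
  ultimately show ?thesis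
    using fin sing by (auto simp: clique_retraction_def connection_graph_def)
qed

theorem corollary5:
  fixes G :: "'a set set" and H :: "'b set set"
    and A :: "'a set pair_pre_digraph" and B :: "'b set pair_pre_digraph"
  assumes "fin_simplicial_complex G" and "fin_simplicial_complex H"
    and "A = connection_graph G" and "B = connection_graph H"
  shows "shannon_capacity (disjoint_union A B) = shannon_capacity A + shannon_capacity B
    \<and> shannon_capacity (strong_product A B) = shannon_capacity A * shannon_capacity B"
proof -
  obtain S f where A: "clique_retraction A S f"
    using clique_retraction_connection_graph[OF assms(1), folded assms(3)] by (rule that)
  obtain T g where B: "clique_retraction B T g"
    using clique_retraction_connection_graph[OF assms(2), folded assms(4)] by (rule that)
  note cap = shannon_capacity_clique_retraction
  have "shannon_capacity (disjoint_union A B) = shannon_capacity A + shannon_capacity B"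
    using cap[OF clique_retraction_disjoint_union[OF A B]] cap[OF A] cap[OF B]
      card_Plus[OF clique_retraction_finite[OF A] clique_retraction_finite[OF B]] by simp
  moreover have "shannon_capacity (strong_product A B) = shannon_capacity A * shannon_capacity B"
    using cap[OF clique_retraction_strong_product[OF A B]] cap[OF A] cap[OF B]
    by (simp add: card_cartesian_product)
  ultimately show ?thesis ..
qed

end
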